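(* Let $N \ge 1$ and let $G$ be a finite undirected bipartite multigraph whose vertex classes are the $N$ send nodes $S(1),\dots,S(N)$ and the $N$ receive nodes $R(1),\dots,R(N)$, where each edge joining $S(i)$ and $R(j)$ represents one block that must be transferred from worker $i$ to worker $j$. Let $\Delta$ be the maximum degree of $G$. Then the minimum number of congestion-free sub-stages needed to transfer all blocks is exactly $\Delta$; equivalently, the minimum number of pairwise disjoint matchings into which the edge set of $G$ can be partitioned is $\Delta$.
   Context: There are $N$ workers. A communication demand among them is encoded as a bipartite multigraph $G$ with $N$ send nodes $S(1),\dots,S(N)$ and $N$ receive nodes $R(1),\dots,R(N)$; each edge between $S(i)$ and $R(j)$ is one block to be sent from worker $i$ to worker $j$ (several blocks may be sent between the same pair of workers, giving parallel edges). Degrees count edges with multiplicity. A congestion-free sub-stage is a set of edges (block transfers performed in that sub-stage) in which each worker sends at most one block and receives at most one block, i.e. every $S(i)$ and every $R(j)$ is incident to at most one edge of the set; this is the same as a matching in $G$. A schedule assigns every edge to exactly one sub-stage, so a schedule with $k$ congestion-free sub-stages is a partition of the edge set of $G$ into $k$ pairwise disjoint matchings. *)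

theory Defs
  imports Main "HOL-Library.Disjoint_Sets"
begin

text \<open>
  An undirected multigraph has a vertex set \<open>V\<close>, a set \<open>E\<close> of edge names and a map
  \<open>ends\<close> sending each edge to its set of endpoints; parallel edges are distinct names
  with the same endpoints.
\<close>

definition degree :: "'e set \<Rightarrow> ('e \<Rightarrow> 'v set) \<Rightarrow> 'v \<Rightarrow> nat" where
  "degree E ends v = card {e \<in> E. v \<in> ends e}"

definition max_degree :: "'v set \<Rightarrow> 'e set \<Rightarrow> ('e \<Rightarrow> 'v set) \<Rightarrow> nat" where
  "max_degree V E ends = Max (degree E ends ` V)"

definition matching :: "'e set \<Rightarrow> ('e \<Rightarrow> 'v set) \<Rightarrow> 'e set \<Rightarrow> bool" where
  "matching E ends M \<longleftrightarrow>
     M \<subseteq> E \<and> (\<forall>e\<in>M. \<forall>f\<in>M. e \<noteq> f \<longrightarrow> ends e \<inter> ends f = {})"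

definition matching_partition :: "'e set \<Rightarrow> ('e \<Rightarrow> 'v set) \<Rightarrow> 'e set set \<Rightarrow> bool" where
  "matching_partition E ends P \<longleftrightarrow> partition_on E P \<and> (\<forall>M\<in>P. matching E ends M)"

datatype node = S nat | R nat

definition nodes :: "nat \<Rightarrow> node set" where
  "nodes N = S ` {1..N} \<union> R ` {1..N}"

definition demand_graph :: "nat \<Rightarrow> 'e set \<Rightarrow> ('e \<Rightarrow> node set) \<Rightarrow> bool" where
  "demand_graph N E ends \<longleftrightarrow>
     finite E \<and> (\<forall>e\<in>E. \<exists>i\<in>{1..N}. \<exists>j\<in>{1..N}. ends e = {S i, R j})"

definition congestion_free :: "nat \<Rightarrow> 'e set \<Rightarrow> ('e \<Rightarrow> node set) \<Rightarrow> 'e set \<Rightarrow> bool" where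
  "congestion_free N E ends M \<longleftrightarrow>
     M \<subseteq> E \<and>
     (\<forall>i\<in>{1..N}. card {e \<in> M. S i \<in> ends e} \<le> 1 \<and> card {e \<in> M. R i \<in> ends e} \<le> 1)"

text \<open>
  \<open>\<sigma> e\<close> is the sub-stage, numbered from 0 to \<open>k - 1\<close>, in which block \<open>e\<close> is transferred.
  Sub-stages may be idle here, whereas the members of a \<open>matching_partition\<close> are nonempty.
\<close>

definition schedule ::
  "nat \<Rightarrow> 'e set \<Rightarrow> ('e \<Rightarrow> node set) \<Rightarrow> nat \<Rightarrow> ('e \<Rightarrow> nat) \<Rightarrow> bool" where
  "schedule N E ends k \<sigma> \<longleftrightarrow>
     (\<forall>e\<in>E. \<sigma> e < k) \<and> (\<forall>t<k. congestion_free N E ends {e \<in> E. \<sigma> e = t})"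

definition is_minimum :: "nat \<Rightarrow> (nat \<Rightarrow> bool) \<Rightarrow> bool" where
  "is_minimum m Q \<longleftrightarrow> Q m \<and> (\<forall>k. Q k \<longrightarrow> m \<le> k)"

end

theory Submission
  imports Defs
begin

text \<open>
  This is Koenig's edge colouring theorem, by induction on the edges. When an edge from
  \<open>u\<close> to \<open>v\<close> is added, some colour \<open>a\<close> is missing at \<open>u\<close> and some colour \<open>b\<close> at \<open>v\<close>. Walk from
  \<open>v\<close> along edges coloured alternately \<open>a\<close> and \<open>b\<close>: each arrival on the send side is by an \<open>a\<close>
  edge, so the walk never reaches \<open>u\<close>, and exchanging \<open>a\<close> and \<open>b\<close> along it frees \<open>a\<close> at
  both ends of the new edge.
\<close>

text \<open>The colour type is left arbitrary so that sub-stage numbers and the members of a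
  partition can both serve as colours.\<close>

definition proper_colouring :: "'e set \<Rightarrow> ('e \<Rightarrow> 'v set) \<Rightarrow> ('e \<Rightarrow> 'c) \<Rightarrow> bool" where
  "proper_colouring E ends c \<longleftrightarrow>
     (\<forall>e\<in>E. \<forall>f\<in>E. e \<noteq> f \<longrightarrow> ends e \<inter> ends f \<noteq> {} \<longrightarrow> c e \<noteq> c f)"

lemma proper_colouring_inj_on:
  "proper_colouring E ends c \<Longrightarrow> inj_on c {e \<in> E. v \<in> ends e}"
  unfolding proper_colouring_def inj_on_def by blast

text \<open>Since no value of \<open>s\<close> is a value of \<open>r\<close>, two edges can only
  meet send to send or receive to receive. This passes from endpoint sets to the pair of endpoint
  functions used in the recolouring argument.\<close>

lemma proper_colouring_bipartite:
  fixes s r :: "'e \<Rightarrow> 'v"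
  assumes "\<forall>e\<in>E. ends e = {s e, r e}" "\<forall>e\<in>E. \<forall>f\<in>E. s e \<noteq> r f"
  shows "proper_colouring E ends c \<longleftrightarrow>
    (\<forall>e\<in>E. \<forall>f\<in>E. e \<noteq> f \<longrightarrow> s e = s f \<or> r e = r f \<longrightarrow> c e \<noteq> c f)"
proof -
  have "ends e \<inter> ends f \<noteq> {} \<longleftrightarrow> s e = s f \<or> r e = r f" if "e \<in> E" "f \<in> E" for e f
  proof -
    have "ends e = {s e, r e}" "ends f = {s f, r f}" "s e \<noteq> r f" "s f \<noteq> r e"
      using assms that by blast+
    then show ?thesis by auto
  qed
  then show ?thesis
    unfolding proper_colouring_def by simp
qed

text \<open>The alternating walk is kept only as its set of edges, so no order or simplicity of a
  path has to be proved. The rules fix the side of entry: an \<open>a\<close> edge is entered at its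
  receive end, a \<open>b\<close> edge at its send end.\<close>

inductive_set kempe_chain :: "'e set \<Rightarrow> ('e \<Rightarrow> 'v) \<Rightarrow> ('e \<Rightarrow> 'v) \<Rightarrow> ('e \<Rightarrow> 'c) \<Rightarrow> 'c \<Rightarrow> 'c \<Rightarrow> 'v \<Rightarrow> 'e set"
  for E s r c a b v where
  start: "f \<in> E \<Longrightarrow> r f = v \<Longrightarrow> c f = a \<Longrightarrow> f \<in> kempe_chain E s r c a b v"
| at_send: "f \<in> kempe_chain E s r c a b v \<Longrightarrow> c f = a \<Longrightarrow> g \<in> E \<Longrightarrow> s g = s f \<Longrightarrow> c g = b
    \<Longrightarrow> g \<in> kempe_chain E s r c a b v"
| at_receive: "f \<in> kempe_chain E s r c a b v \<Longrightarrow> c f = b \<Longrightarrow> g \<in> E \<Longrightarrow> r g = r f \<Longrightarrow> c g = a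
    \<Longrightarrow> g \<in> kempe_chain E s r c a b v"

lemma recolour_to_free:
  fixes s r :: "'e \<Rightarrow> 'v" and c :: "'e \<Rightarrow> 'c"
  assumes proper: "\<And>e f. e \<in> E \<Longrightarrow> f \<in> E \<Longrightarrow> e \<noteq> f \<Longrightarrow> s e = s f \<or> r e = r f \<Longrightarrow> c e \<noteq> c f"
    and a_free: "\<And>f. f \<in> E \<Longrightarrow> s f = u \<Longrightarrow> c f \<noteq> a"
    and b_free: "\<And>f. f \<in> E \<Longrightarrow> r f = v \<Longrightarrow> c f \<noteq> b"
  obtains c' where
    "\<And>e f. e \<in> E \<Longrightarrow> f \<in> E \<Longrightarrow> e \<noteq> f \<Longrightarrow> s e = s f \<or> r e = r f \<Longrightarrow> c' e \<noteq> c' f"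
    "\<And>f. f \<in> E \<Longrightarrow> c' f \<in> {c f, a, b}"
    "\<And>f. f \<in> E \<Longrightarrow> s f = u \<or> r f = v \<Longrightarrow> c' f \<noteq> a"
proof
  define K where "K = kempe_chain E s r c a b v"
  define c' where "c' = (\<lambda>f. if f \<in> K then (if c f = a then b else a) else c f)"
  have K: "f \<in> E \<and> (c f = a \<or> c f = b)" if "f \<in> K" for f
    using that unfolding K_def by induction auto
  have pred_b: "\<exists>h\<in>K. c h = a \<and> s h = s f" if "f \<in> K" "c f = b" "a \<noteq> b" for f
    using that unfolding K_def by (cases rule: kempe_chain.cases) auto
  have pred_a: "r f = v \<or> (\<exists>h\<in>K. c h = b \<and> r h = r f)" if "f \<in> K" "c f = a" "a \<noteq> b" for f
    using that unfolding K_def by (cases rule: kempe_chain.cases) auto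
  \<comment> \<open>A chain must start with an \<open>a\<close> edge at \<open>v\<close>, and
    \<open>b\<close> is absent there. If the two colours coincide, nothing is exchanged.\<close>
  have "K = {}" if "a = b"
  proof -
    have False if "f \<in> K" for f
      using that unfolding K_def by induction (use \<open>a = b\<close> b_free in auto)
    then show ?thesis by blast
  qed
  then have neq: "a \<noteq> b" if "f \<in> K" for f
    using that by blast
  \<comment> \<open>The rules extend the chain only at the end where an edge is left. At the end
    where \<open>f\<close> was entered, the predecessor \<open>h\<close> of \<open>f\<close> has the
    colour of \<open>g\<close>, so properness gives \<open>g = h\<close>. If \<open>f\<close> has no
    predecessor, it is an \<open>a\<close> edge at \<open>v\<close>, where no \<open>b\<close> edge
    can meet it.\<close>
  have closed: "g \<in> K"
    if f: "f \<in> K" and g: "g \<in> E" "c g = a \<or> c g = b" and adj: "s f = s g \<or> r f = r g" for f g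
  proof (cases "f = g")
    case False
    then have "c f \<noteq> c g"
      using proper f g adj K by blast
    then consider "c f = a" "c g = b" | "c f = b" "c g = a"
      using K[OF f] g by auto
    then show ?thesis
    proof cases
      case 1
      show ?thesis
      proof (cases "s f = s g")
        case True
        then show ?thesis
          using f g 1 unfolding K_def by (auto intro: kempe_chain.at_send)
      next
        case False
        then have rfg: "r f = r g" using adj by blast
        then have "r f \<noteq> v" using b_free g(1) 1 by metis
        then obtain h where "h \<in> K" "c h = b" "r h = r f"
          using pred_a f 1 neq by blast
        then show ?thesis
          using proper[of h g] K g(1) rfg 1 by metis
      qed
    next
      case 2
      show ?thesis
      proof (cases "r f = r g")
        case True
        then show ?thesis
          using f g 2 unfolding K_def by (auto intro: kempe_chain.at_receive)
      next
        case False
        then have sfg: "s f = s g" using adj by blast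
        obtain h where "h \<in> K" "c h = a" "s h = s f"
          using pred_b f 2 neq by blast
        then show ?thesis
          using proper[of h g] K g(1) sfg 2 by metis
      qed
    qed
  qed (use f in simp)
  show "c' e \<noteq> c' f" if "e \<in> E" "f \<in> E" "e \<noteq> f" "s e = s f \<or> r e = r f" for e f
  proof -
    have "c e \<noteq> c f" using proper that by blast
    \<comment> \<open>Adjacent edges with both colours in \<open>{a, b}\<close> are thus swapped
      together or not at all. Any other colour is unaffected and differs from both \<open>a\<close>
      and \<open>b\<close>.\<close>
    moreover have "e \<in> K \<longleftrightarrow> f \<in> K" if "c e \<in> {a, b}" "c f \<in> {a, b}"
      using closed[of e f] closed[of f e] that \<open>e \<in> E\<close> \<open>f \<in> E\<close> \<open>s e = s f \<or> r e = r f\<close> by auto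
    ultimately show ?thesis
      using K[of e] K[of f] unfolding c'_def by auto
  qed
  show "c' f \<in> {c f, a, b}" for f
    unfolding c'_def by simp
  show "c' f \<noteq> a" if "f \<in> E" "s f = u \<or> r f = v" for f
  proof (cases "f \<in> K")
    case True
    have "c f = a"
    proof (rule ccontr)
      assume "c f \<noteq> a"
      then have "c f = b" using K True by blast
      then have "s f = u" using that b_free by blast
      \<comment> \<open>A \<open>b\<close> edge of the chain at \<open>u\<close> would have been
        entered there from an \<open>a\<close> edge, which \<open>u\<close> lacks.\<close>
      then show False
        using pred_b[OF True \<open>c f = b\<close> neq[OF True]] a_free K by metis
    qed
    then show ?thesis
      using True neq[OF True] unfolding c'_def by simp
  next
    case False
    then have "\<not> (r f = v \<and> c f = a)"
      using \<open>f \<in> E\<close> kempe_chain.start unfolding K_def by metis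
    then show ?thesis
      using False that a_free unfolding c'_def by auto
  qed
qed

lemma free_colour:
  assumes "finite A" "card A < k"
  obtains a where "a < k" "\<And>f. f \<in> A \<Longrightarrow> c f \<noteq> (a::nat)"
proof -
  have "card (c ` A) < card {..<k}"
    using assms card_image_le[of A c] by simp
  then have "\<not> {..<k} \<subseteq> c ` A"
    using assms(1) by (metis card_mono finite_imageI not_le)
  then show thesis using that by blast
qed

text \<open>Values of \<open>s\<close> are compared only with values of \<open>s\<close>, and
  likewise for \<open>r\<close>, which builds the two sides into the statement. Bounding fibres by a
  fixed \<open>k\<close>, instead of by the maximum degree, lets the induction keep the same
  \<open>k\<close> for the smaller edge set.\<close>

lemma koenig_edge_colouring:
  fixes s r :: "'e \<Rightarrow> 'v"
  assumes "finite E" "\<And>x. card {e \<in> E. s e = x} \<le> k" "\<And>x. card {e \<in> E. r e = x} \<le> k"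
  shows "\<exists>c. (\<forall>e\<in>E. c e < k) \<and>
    (\<forall>e\<in>E. \<forall>f\<in>E. e \<noteq> f \<longrightarrow> s e = s f \<or> r e = r f \<longrightarrow> c e \<noteq> c f)"
  using assms
proof (induction E rule: finite_induct)
  case (insert e0 E)
  have grow: "card {e \<in> E. p e = x} \<le> card {e \<in> insert e0 E. p e = x}" for p :: "'e \<Rightarrow> 'v" and x
    using insert.hyps by (intro card_mono) auto
  obtain c where c: "\<And>e. e \<in> E \<Longrightarrow> c e < k"
    "\<And>e f. e \<in> E \<Longrightarrow> f \<in> E \<Longrightarrow> e \<noteq> f \<Longrightarrow> s e = s f \<or> r e = r f \<Longrightarrow> c e \<noteq> c f"
    using insert.IH[OF le_trans[OF grow insert.prems(1)] le_trans[OF grow insert.prems(2)]] by blast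
  \<comment> \<open>The edge \<open>e0\<close> itself takes one place in each of its two fibres, so
    at most \<open>k - 1\<close> old edges lie at either end and a colour is left over.\<close>
  have strict: "card {e \<in> E. p e = p e0} < card {e \<in> insert e0 E. p e = p e0}" for p :: "'e \<Rightarrow> 'v"
    using insert.hyps by (intro psubset_card_mono) auto
  obtain a where a: "a < k" "\<And>f. f \<in> {e \<in> E. s e = s e0} \<Longrightarrow> c f \<noteq> a"
    using free_colour[of "{e \<in> E. s e = s e0}" k c] insert.hyps(1) less_le_trans[OF strict[of s] insert.prems(1)]
    by auto
  obtain b where b: "b < k" "\<And>f. f \<in> {e \<in> E. r e = r e0} \<Longrightarrow> c f \<noteq> b"
    using free_colour[of "{e \<in> E. r e = r e0}" k c] insert.hyps(1) less_le_trans[OF strict[of r] insert.prems(2)]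
    by auto
  obtain c' where c': "\<And>e f. e \<in> E \<Longrightarrow> f \<in> E \<Longrightarrow> e \<noteq> f \<Longrightarrow> s e = s f \<or> r e = r f \<Longrightarrow> c' e \<noteq> c' f"
    "\<And>f. f \<in> E \<Longrightarrow> c' f \<in> {c f, a, b}"
    "\<And>f. f \<in> E \<Longrightarrow> s f = s e0 \<or> r f = r e0 \<Longrightarrow> c' f \<noteq> a"
    using recolour_to_free[of E s r c "s e0" a "r e0" b] c(2) a(2) b(2) by blast
  have "c' f < k" if "f \<in> E" for f
    using c'(2)[OF that] c(1)[OF that] a(1) b(1) by auto
  moreover have "(c'(e0 := a)) e \<noteq> (c'(e0 := a)) f"
    if ef: "e \<in> insert e0 E" "f \<in> insert e0 E" "e \<noteq> f" "s e = s f \<or> r e = r f" for e f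
  proof -
    consider "e = e0" "f \<in> E" "f \<noteq> e0" | "f = e0" "e \<in> E" "e \<noteq> e0" | "e \<in> E" "f \<in> E" "e \<noteq> e0" "f \<noteq> e0"
      using ef(1-3) by blast
    then show ?thesis
      using c'(1)[of e f] c'(3)[of e] c'(3)[of f] ef(3,4) by cases force+
  qed
  ultimately have "(\<forall>e\<in>insert e0 E. (c'(e0 := a)) e < k) \<and>
    (\<forall>e\<in>insert e0 E. \<forall>f\<in>insert e0 E. e \<noteq> f \<longrightarrow> s e = s f \<or> r e = r f
      \<longrightarrow> (c'(e0 := a)) e \<noteq> (c'(e0 := a)) f)"
    using a(1) by simp
  then show ?case by blast
qed simp

text \<open>A bound of one edge per node and sub-stage says that meeting edges get different
  sub-stages. Checking the numbered workers suffices, as all endpoints lie in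
  \<open>nodes N\<close>.\<close>

lemma schedule_iff_proper_colouring:
  assumes "demand_graph N E ends"
  shows "schedule N E ends k \<sigma> \<longleftrightarrow> (\<forall>e\<in>E. \<sigma> e < k) \<and> proper_colouring E ends \<sigma>"
proof
  have fin: "finite E" and ends: "\<And>e. e \<in> E \<Longrightarrow> ends e \<subseteq> nodes N"
    using assms unfolding demand_graph_def nodes_def by fastforce+
  have le1: "card {e \<in> {e \<in> E. \<sigma> e = t}. v \<in> ends e} \<le> 1 \<longleftrightarrow>
    (\<forall>e\<in>E. \<forall>f\<in>E. \<sigma> e = t \<longrightarrow> \<sigma> f = t \<longrightarrow> v \<in> ends e \<longrightarrow> v \<in> ends f \<longrightarrow> e = f)" for t v
    using fin by (auto simp: card_le_Suc0_iff_eq)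
  {
    assume sched: "schedule N E ends k \<sigma>"
    have "e = f" if "e \<in> E" "f \<in> E" "v \<in> ends e" "v \<in> ends f" "\<sigma> e = \<sigma> f" for e f v
    proof -
      have "\<sigma> e < k" "v \<in> nodes N"
        using sched that ends unfolding schedule_def by auto
      then have "card {g \<in> {g \<in> E. \<sigma> g = \<sigma> e}. v \<in> ends g} \<le> 1"
        using sched unfolding schedule_def congestion_free_def nodes_def by auto
      then show ?thesis unfolding le1 using that by metis
    qed
    then show "(\<forall>e\<in>E. \<sigma> e < k) \<and> proper_colouring E ends \<sigma>"
      using sched unfolding schedule_def proper_colouring_def by blast
  next
    assume "(\<forall>e\<in>E. \<sigma> e < k) \<and> proper_colouring E ends \<sigma>"
    then show "schedule N E ends k \<sigma>"
      unfolding schedule_def congestion_free_def le1 proper_colouring_def by blast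
  }
qed

text \<open>Edges at \<open>v\<close> meet pairwise, so their colours are distinct. This is the
  lower bound for both minima.\<close>

lemma degree_le_colours:
  assumes "proper_colouring E ends c" "c ` E \<subseteq> A" "finite A"
  shows "degree E ends v \<le> card A"
  unfolding degree_def
  using proper_colouring_inj_on[OF assms(1)] assms(2,3) by (intro card_inj_on_le[of c]) auto

text \<open>Colour each edge by the member of \<open>P\<close> that contains it.\<close>

lemma matching_partition_colouring:
  assumes "matching_partition E ends P"
  obtains c where "proper_colouring E ends c" "c ` E \<subseteq> P"
proof -
  have "\<forall>e\<in>E. \<exists>M\<in>P. e \<in> M"
    using assms unfolding matching_partition_def partition_on_def by blast
  then obtain c where c: "\<And>e. e \<in> E \<Longrightarrow> c e \<in> P \<and> e \<in> c e"
    by metis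
  then have "proper_colouring E ends c"
    using assms unfolding proper_colouring_def matching_partition_def matching_def by metis
  then show thesis using c that by blast
qed

text \<open>Requiring \<open>c\<close> to be onto \<open>A\<close> makes every colour class
  nonempty, as \<open>partition_on\<close> demands, and keeps classes of different colours
  distinct.\<close>

lemma colouring_matching_partition:
  assumes "proper_colouring E ends c" "c ` E = A"
  shows "matching_partition E ends ((\<lambda>t. {e \<in> E. c e = t}) ` A)"
    and "card ((\<lambda>t. {e \<in> E. c e = t}) ` A) = card A"
proof -
  show "matching_partition E ends ((\<lambda>t. {e \<in> E. c e = t}) ` A)"
    using assms unfolding matching_partition_def matching_def proper_colouring_def
    by (intro conjI partition_onI) (auto simp: disjnt_def, metis IntI empty_iff)
  have "inj_on (\<lambda>t. {e \<in> E. c e = t}) A"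
    using assms(2) unfolding inj_on_def by blast
  then show "card ((\<lambda>t. {e \<in> E. c e = t}) ` A) = card A"
    by (rule card_image)
qed

lemma demand_graph_colouring:
  assumes "N \<ge> 1" "demand_graph N E ends"
  shows "\<exists>c. (\<forall>e\<in>E. c e < max_degree (nodes N) E ends) \<and> proper_colouring E ends c"
proof -
  let ?\<Delta> = "max_degree (nodes N) E ends"
  have fin: "finite E" using assms(2) unfolding demand_graph_def by blast
  have "\<forall>e\<in>E. \<exists>x y. x \<in> S ` {1..N} \<and> y \<in> R ` {1..N} \<and> ends e = {x, y}"
    using assms(2) unfolding demand_graph_def by blast
  then obtain s r where sr: "\<And>e. e \<in> E \<Longrightarrow> s e \<in> S ` {1..N} \<and> r e \<in> R ` {1..N} \<and> ends e = {s e, r e}"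
    by metis
  \<comment> \<open>Here \<open>p\<close> stands for \<open>s\<close> or \<open>r\<close>. Fibres
    over nodes are bounded by the degree; fibres over any other value are empty.\<close>
  have "card {e \<in> E. p e = x} \<le> ?\<Delta>" if p: "\<And>e. e \<in> E \<Longrightarrow> p e \<in> nodes N \<inter> ends e" for p x
  proof (cases "x \<in> nodes N")
    case True
    have "card {e \<in> E. p e = x} \<le> degree E ends x"
      unfolding degree_def using fin p by (intro card_mono) auto
    also have "\<dots> \<le> ?\<Delta>"
      unfolding max_degree_def using True by (intro Max_ge) (auto simp: nodes_def)
    finally show ?thesis .
  next
    case False
    then have "{e \<in> E. p e = x} = {}" using p by blast
    then show ?thesis by (metis card.empty le0)
  qed
  from this[of s] this[of r] have "\<exists>c. (\<forall>e\<in>E. c e < ?\<Delta>) \<and>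
    (\<forall>e\<in>E. \<forall>f\<in>E. e \<noteq> f \<longrightarrow> s e = s f \<or> r e = r f \<longrightarrow> c e \<noteq> c f)"
    using sr fin by (intro koenig_edge_colouring) (auto simp: nodes_def)
  moreover have "\<forall>e\<in>E. ends e = {s e, r e}"
    using sr by blast
  moreover have "\<forall>e\<in>E. \<forall>f\<in>E. s e \<noteq> r f"
    using sr by (metis image_iff node.distinct(1))
  ultimately show ?thesis
    using proper_colouring_bipartite[of E ends s r] by blast
qed

theorem mainTheorem1:
  fixes N :: nat and E :: "'e set" and ends :: "'e \<Rightarrow> node set"
  assumes "N \<ge> 1"
    and "demand_graph N E ends"
  shows "is_minimum (max_degree (nodes N) E ends) (\<lambda>k. \<exists>\<sigma>. schedule N E ends k \<sigma>) \<and>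
         is_minimum (max_degree (nodes N) E ends)
           (\<lambda>k. \<exists>P. matching_partition E ends P \<and> card P = k)"
proof -
  let ?\<Delta> = "max_degree (nodes N) E ends"
  have fin: "finite E" using assms(2) unfolding demand_graph_def by blast
  have "?\<Delta> \<in> degree E ends ` nodes N"
    unfolding max_degree_def using assms(1) by (intro Max_in) (auto simp: nodes_def)
  then obtain v where v: "degree E ends v = ?\<Delta>" by (metis imageE)
  obtain c where c: "\<And>e. e \<in> E \<Longrightarrow> c e < ?\<Delta>" "proper_colouring E ends c"
    using demand_graph_colouring[OF assms] by blast
  \<comment> \<open>A node of maximum degree sees \<Delta> distinct colours, so every colour occurs
    and the colour classes number exactly \<Delta>.\<close>
  have "?\<Delta> \<le> card (c ` E)"
    using degree_le_colours[OF c(2) order.refl] fin v by (metis finite_imageI)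
  then have "c ` E = {..<?\<Delta>}"
    using c(1) by (intro card_seteq) auto
  then have "\<exists>P. matching_partition E ends P \<and> card P = ?\<Delta>"
    using colouring_matching_partition[OF c(2)] by (metis card_lessThan)
  moreover have "?\<Delta> \<le> card P" if P: "matching_partition E ends P" for P
  proof -
    have "finite P"
      using P fin finite_elements unfolding matching_partition_def by blast
    then show ?thesis
      using matching_partition_colouring[OF P] degree_le_colours v by metis
  qed
  moreover have "\<exists>\<sigma>. schedule N E ends ?\<Delta> \<sigma>"
    using c schedule_iff_proper_colouring[OF assms(2)] by blast
  moreover have "?\<Delta> \<le> k" if "schedule N E ends k \<sigma>" for k \<sigma>
  proof -
    have "\<sigma> ` E \<subseteq> {..<k}" "proper_colouring E ends \<sigma>"
      using that schedule_iff_proper_colouring[OF assms(2)] by auto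
    then show ?thesis
      using degree_le_colours[of E ends \<sigma> "{..<k}" v] v by simp
  qed
  ultimately show ?thesis
    unfolding is_minimum_def by blast
qed

end
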